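(* Let $f\in C^0(\overline{H^2})\cap C^\infty(H^2)$ satisfy $f\ge 0$ and $$f_{xx}+f_{yy}+\frac{3}{x}f_x=0\quad\text{on } H^2 .$$ Then $f$ is constant.
   Context: $H^2=\{(x,y)\in\mathbb{R}^2: x>0\}$ denotes the open right half-plane and $\overline{H^2}=\{x\ge 0\}$ its closure. *)

theory Defs
  imports "HOL-Analysis.Analysis"
begin

definition closed_half_plane :: "(real \<times> real) set" where
  "closed_half_plane = {p. fst p \<ge> 0}"

definition open_half_plane :: "(real \<times> real) set" where
  "open_half_plane = {p. fst p > 0}"

definition partial_x :: "(real \<times> real \<Rightarrow> real) \<Rightarrow> real \<times> real \<Rightarrow> real" where
  "partial_x f = (\<lambda>(x, y). deriv (\<lambda>t. f (t, y)) x)"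

definition partial_y :: "(real \<times> real \<Rightarrow> real) \<Rightarrow> real \<times> real \<Rightarrow> real" where
  "partial_y f = (\<lambda>(x, y). deriv (\<lambda>t. f (x, t)) y)"

fun dpart :: "bool list \<Rightarrow> (real \<times> real \<Rightarrow> real) \<Rightarrow> real \<times> real \<Rightarrow> real" where
  "dpart [] f = f"
| "dpart (b # bs) f = (if b then partial_x else partial_y) (dpart bs f)"

text \<open>C-infinity on an open set: every iterated partial derivative is (Frechet)
  differentiable there (hence continuous, and all partials of all orders exist
  and are continuous).\<close>
definition smooth_on :: "(real \<times> real) set \<Rightarrow> (real \<times> real \<Rightarrow> real) \<Rightarrow> bool" where
  "smooth_on S f \<longleftrightarrow> (\<forall>bs. dpart bs f differentiable_on S)"

end

(* In polar coordinates r = exp t, s = sin(theta) the equation for u(t, s) = f reads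
     u_tt + 3 u_t + (1 - s^2) u_ss - 4 s u_s = 0,
   and (1 - s^2) u_ss - 4 s u_s is self-adjoint for the weight 1 - s^2 on [-1, 1]. Hence the moments
   m_n(t) = integral of u(t, s) s^n (1 - s^2) ds satisfy
     m_n'' + 3 m_n' - n (n + 3) m_n = - n (n - 1) m_(n-2).
   The derivatives of f are not controlled near the axis s = 1, s = -1, so this is derived with the weight
   a^2 - s^2 on [-a, a]: it vanishes at the ends, the boundary term contains no derivative of u, and all
   error terms are O(1 - a^2). A maximum principle for the ODE lets a tend to 1.
   The homogeneous solutions are exp(n t) and exp(-(n + 3) t). As f is bounded near the origin, m_0 is
   constant; as f is nonnegative, |m_n| is at most m_0, so inductively every m_n is a bounded solution
   and therefore constant. By Weierstrass u does not depend on t, and continuity at the origin finishes. *)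

theory Submission
  imports Defs
begin

section \<open>Partial derivatives and ordinary differential inequalities\<close>

text \<open>\<open>partial_x\<close> and \<open>partial_y\<close> are limits along coordinate lines
  only. Frechet differentiability identifies them with the values of the derivative on the basis
  vectors, which the chain rule along curves uses.\<close>

lemma has_derivative_partials:
  assumes "g differentiable (at (x, y))"
  shows "(g has_derivative (\<lambda>h. partial_x g (x, y) * fst h + partial_y g (x, y) * snd h)) (at (x, y))"
proof -
  obtain g' where g': "(g has_derivative g') (at (x, y))"
    using assms by (auto simp: differentiable_def)
  interpret g': bounded_linear g'
    using g' by (rule has_derivative_bounded_linear)
  have d1: "((\<lambda>t. g (t, y)) has_derivative (\<lambda>h. g' (h, 0))) (at x)"
    by (rule has_derivative_compose[where f = "\<lambda>t. (t, y)" and g = g])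
       (auto intro!: derivative_eq_intros g')
  have g1: "g' (h, 0) = g' (1, 0) * h" for h
    using g'.scaleR[of h "(1, 0)"] by (simp add: mult.commute)
  have "((\<lambda>t. g (t, y)) has_real_derivative g' (1, 0)) (at x)"
    unfolding has_field_derivative_def by (rule has_derivative_eq_rhs[OF d1]) (rule ext, rule g1)
  then have px: "partial_x g (x, y) = g' (1, 0)"
    by (simp add: partial_x_def DERIV_imp_deriv)
  have d2: "((\<lambda>t. g (x, t)) has_derivative (\<lambda>h. g' (0, h))) (at y)"
    by (rule has_derivative_compose[where f = "\<lambda>t. (x, t)" and g = g])
       (auto intro!: derivative_eq_intros g')
  have g2: "g' (0, h) = g' (0, 1) * h" for h
    using g'.scaleR[of h "(0, 1)"] by (simp add: mult.commute)
  have "((\<lambda>t. g (x, t)) has_real_derivative g' (0, 1)) (at y)"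
    unfolding has_field_derivative_def by (rule has_derivative_eq_rhs[OF d2]) (rule ext, rule g2)
  then have py: "partial_y g (x, y) = g' (0, 1)"
    by (simp add: partial_y_def DERIV_imp_deriv)
  have "g' h = partial_x g (x, y) * fst h + partial_y g (x, y) * snd h" for h
    using g'.add[of "(fst h, 0)" "(0, snd h)"] g1[of "fst h"] g2[of "snd h"] px py by simp
  then show ?thesis
    using g' by presburger
qed

lemma partials_chain_rule:
  assumes "g differentiable (at (X t, Y t))"
    and X: "(X has_real_derivative X') (at t)" and Y: "(Y has_real_derivative Y') (at t)"
  shows "((\<lambda>t. g (X t, Y t)) has_real_derivative
    partial_x g (X t, Y t) * X' + partial_y g (X t, Y t) * Y') (at t)"
proof -
  have "((\<lambda>t. g (X t, Y t)) has_derivative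
    (\<lambda>h. partial_x g (X t, Y t) * fst (X' * h, Y' * h) + partial_y g (X t, Y t) * snd (X' * h, Y' * h))) (at t)"
    by (rule has_derivative_compose[where f = "\<lambda>t. (X t, Y t)" and g = g])
       (use assms in \<open>auto intro!: has_derivative_Pair has_derivative_partials simp: has_field_derivative_def\<close>)
  then show ?thesis
    unfolding has_field_derivative_def by (rule has_derivative_eq_rhs) (auto simp: algebra_simps)
qed

text \<open>At a positive interior maximum the term in \<open>g'\<close> vanishes and
  \<open>l * g\<close> is nonnegative, so the strict inequality forces \<open>g'' > 0\<close> there;
  then \<open>g\<close> increases just to the right, a contradiction. Strictness covers
  \<open>l = 0\<close>, the case of the zeroth moment.\<close>

lemma ode_maximum_principle:
  fixes g g' g'' :: "real \<Rightarrow> real"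
  assumes g: "\<And>t. (g has_real_derivative g' t) (at t)"
    and g': "\<And>t. (g' has_real_derivative g'' t) (at t)"
    and "l \<ge> 0" and pos: "\<And>t. a < t \<Longrightarrow> t < b \<Longrightarrow> g'' t + k * g' t - l * g t > 0"
    and "g a \<le> 0" "g b \<le> 0" and t: "t \<in> {a..b}"
  shows "g t \<le> 0"
proof (rule ccontr)
  assume "\<not> g t \<le> 0"
  have "continuous_on {a..b} g"
    using g by (meson DERIV_atLeastAtMost_imp_continuous_on)
  then obtain z where z: "z \<in> {a..b}" and max: "\<And>s. s \<in> {a..b} \<Longrightarrow> g s \<le> g z"
    using continuous_attains_sup[of "{a..b}" g] t by force
  have "g z > 0"
    using max[OF t] \<open>\<not> g t \<le> 0\<close> by linarith
  with assms z have ab: "a < z" "z < b"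
    by (smt (verit) atLeastAtMost_iff)+
  have "g' z = 0"
  proof (rule DERIV_local_max[OF g])
    show "0 < min (z - a) (b - z)"
      using ab by simp
    show "\<forall>y. \<bar>z - y\<bar> < min (z - a) (b - z) \<longrightarrow> g y \<le> g z"
      by (auto intro!: max)
  qed
  then have "g'' z > 0"
    using pos[OF ab] mult_nonneg_nonneg[OF \<open>l \<ge> 0\<close> less_imp_le[OF \<open>g z > 0\<close>]] by simp
  then obtain d where "d > 0" and d: "\<And>h. 0 < h \<Longrightarrow> h < d \<Longrightarrow> g' z < g' (z + h)"
    using DERIV_pos_inc_right[OF g'] by blast
  define e where "e = min d (b - z) / 2"
  have e: "0 < e" "e < d" "z + e \<in> {a..b}"
    using \<open>d > 0\<close> ab unfolding e_def by (auto simp: min_def field_simps)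
  have "g z < g (z + e)"
  proof (rule DERIV_pos_imp_increasing_open[where f = g])
    fix x assume "z < x" "x < z + e"
    then show "\<exists>y. (g has_real_derivative y) (at x) \<and> 0 < y"
      using d[of "x - z"] e \<open>g' z = 0\<close> g by auto
  qed (use e g in \<open>auto intro: DERIV_atLeastAtMost_imp_continuous_on\<close>)
  with max[OF e(3)] show False
    by simp
qed

text \<open>The barriers \<open>exp (n * t)\<close> and \<open>exp (- (n + 3) * t)\<close> solve the homogeneous equation, and
  \<open>b - t\<close> absorbs the right-hand side, uniformly down to \<open>n = 0\<close>.\<close>

lemma euler_ode_bound:
  fixes g g' g'' :: "real \<Rightarrow> real"
  assumes g: "\<And>t. (g has_real_derivative g' t) (at t)"
    and g': "\<And>t. (g' has_real_derivative g'' t) (at t)"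
    and "n \<ge> 0" "\<eta> > 0"
    and bound: "\<And>t. a < t \<Longrightarrow> t < b \<Longrightarrow> \<bar>g'' t + 3 * g' t - n * (n + 3) * g t\<bar> \<le> \<eta>"
    and t: "t \<in> {a..b}"
  shows "\<bar>g t\<bar> \<le> \<bar>g a\<bar> * exp (- (n + 3) * (t - a)) + \<bar>g b\<bar> * exp (n * (t - b)) + \<eta> * (b - t)"
proof -
  define p where "p = (\<lambda>t. \<bar>g a\<bar> * exp (- (n + 3) * (t - a)))"
  define q where "q = (\<lambda>t. \<bar>g b\<bar> * exp (n * (t - b)))"
  have p: "(p has_real_derivative - ((n + 3) * p t)) (at t)" for t
    unfolding p_def by (auto intro!: derivative_eq_intros simp: algebra_simps)
  have q: "(q has_real_derivative n * q t) (at t)" for t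
    unfolding q_def by (auto intro!: derivative_eq_intros)
  have nonneg: "p t \<ge> 0" "q t \<ge> 0" for t
    by (auto simp: p_def q_def)
  have ends: "p a = \<bar>g a\<bar>" "q b = \<bar>g b\<bar>"
    by (auto simp: p_def q_def)
  \<comment> \<open>The signs 1 and -1 for \<open>\<sigma>\<close> give the two halves of the
    absolute value bound.\<close>
  have "\<sigma> * g t - p t - q t - \<eta> * (b - t) \<le> 0" if \<sigma>: "\<bar>\<sigma>\<bar> = 1" for \<sigma>
  proof (rule ode_maximum_principle[where g = "\<lambda>t. \<sigma> * g t - p t - q t - \<eta> * (b - t)" and t = t
      and a = a and b = b and k = 3 and l = "n * (n + 3)"])
    show "((\<lambda>t. \<sigma> * g t - p t - q t - \<eta> * (b - t)) has_real_derivative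
      \<sigma> * g' t + (n + 3) * p t - n * q t + \<eta>) (at t)" for t
      by (rule derivative_eq_intros g p q refl)+ simp
    show "((\<lambda>t. \<sigma> * g' t + (n + 3) * p t - n * q t + \<eta>) has_real_derivative
      \<sigma> * g'' t - (n + 3)\<^sup>2 * p t - n\<^sup>2 * q t) (at t)" for t
      by (rule derivative_eq_intros g' p q refl)+ (simp add: power2_eq_square algebra_simps)
    show "0 \<le> n * (n + 3)"
      using \<open>n \<ge> 0\<close> by simp
    fix s assume s: "a < s" "s < b"
    \<comment> \<open>Both barriers cancel. The term \<open>b - t\<close> contributes
      \<open>3 * \<eta>\<close> through its first derivative, which strictly exceeds the error
      \<open>\<eta>\<close>, and its zeroth-order part has the favourable sign.\<close>
    have "\<sigma> * g'' s - (n + 3)\<^sup>2 * p s - n\<^sup>2 * q s + 3 * (\<sigma> * g' s + (n + 3) * p s - n * q s + \<eta>)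
        - n * (n + 3) * (\<sigma> * g s - p s - q s - \<eta> * (b - s))
      = \<sigma> * (g'' s + 3 * g' s - n * (n + 3) * g s) + 3 * \<eta> + n * (n + 3) * (\<eta> * (b - s))"
      by (simp add: algebra_simps power2_eq_square)
    moreover have "\<bar>\<sigma> * (g'' s + 3 * g' s - n * (n + 3) * g s)\<bar> \<le> \<eta>"
      using bound[OF s] \<sigma> by (simp add: abs_mult)
    moreover have "n * (n + 3) * (\<eta> * (b - s)) \<ge> 0"
      using \<open>n \<ge> 0\<close> \<open>\<eta> > 0\<close> s by simp
    ultimately show "\<sigma> * g'' s - (n + 3)\<^sup>2 * p s - n\<^sup>2 * q s
        + 3 * (\<sigma> * g' s + (n + 3) * p s - n * q s + \<eta>)
        - n * (n + 3) * (\<sigma> * g s - p s - q s - \<eta> * (b - s)) > 0"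
      using \<open>\<eta> > 0\<close> by linarith
  next
    have *: "\<sigma> * g r \<le> \<bar>g r\<bar>" for r
      using abs_ge_self[of "\<sigma> * g r"] \<sigma> by (simp add: abs_mult)
    have "\<eta> * (b - a) \<ge> 0"
      using \<open>\<eta> > 0\<close> t by simp
    then show "\<sigma> * g a - p a - q a - \<eta> * (b - a) \<le> 0" "\<sigma> * g b - p b - q b - \<eta> * (b - b) \<le> 0"
      using nonneg(2)[of a] nonneg(1)[of b] ends *[of a] *[of b] by simp_all
  qed (use t in auto)
  from this[of 1] this[of "-1"] show ?thesis
    by (auto simp: p_def q_def)
qed

text \<open>Used with \<open>x\<close> as the distance from a fixed point to the receding ends of a
  comparison interval.\<close>

lemma nonpos_if_le_exp_decay:
  fixes y C :: real
  assumes "\<And>x. x \<ge> 0 \<Longrightarrow> y \<le> C * exp (- x)"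
  shows "y \<le> 0"
proof -
  have "((\<lambda>x. exp (- x :: real)) \<longlongrightarrow> 0) at_top"
    by (rule filterlim_compose[OF exp_at_bot filterlim_uminus_at_bot_at_top])
  from tendsto_mult_left[OF this, of C] have "((\<lambda>x. C * exp (- x)) \<longlongrightarrow> 0) at_top"
    by simp
  moreover have "eventually (\<lambda>x. y \<le> C * exp (- x)) at_top"
    using eventually_ge_at_top[of 0] by eventually_elim (rule assms)
  ultimately show ?thesis
    by (rule tendsto_lowerbound) simp
qed

lemma nat_cases_2: obtains "(n::nat) = 0" | "n = 1" | m where "n = Suc (Suc m)"
  by (metis One_nat_def not0_implies_Suc)

section \<open>Polar coordinates\<close>

text \<open>The variables are \<open>t = ln r\<close> and the sine \<open>s\<close> of the polar angle.\<close>

definition pt :: "real \<Rightarrow> real \<Rightarrow> real \<times> real" where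
  "pt t s = (exp t * sqrt (1 - s\<^sup>2), exp t * s)"

definition polar :: "(real \<times> real \<Rightarrow> real) \<Rightarrow> real \<Rightarrow> real \<Rightarrow> real" where
  "polar f t s = f (pt t s)"

lemma sq_less_1: "\<bar>s\<bar> < 1 \<Longrightarrow> 1 - s\<^sup>2 > (0::real)"
  by (simp add: abs_square_less_1)

lemma pt_open: "\<bar>s\<bar> < 1 \<Longrightarrow> pt t s \<in> open_half_plane"
  using sq_less_1[of s] by (simp add: pt_def open_half_plane_def)

lemma pt_closed: "\<bar>s\<bar> \<le> 1 \<Longrightarrow> pt t s \<in> closed_half_plane"
  by (simp add: pt_def closed_half_plane_def abs_square_le_1)

lemma continuous_on_pt: "continuous_on A (\<lambda>p. pt (fst p) (snd p))"
  unfolding pt_def by (intro continuous_intros)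

lemma DERIV_sqrt_circle:
  "\<bar>s\<bar> < 1 \<Longrightarrow> ((\<lambda>s. sqrt (1 - s\<^sup>2)) has_real_derivative - s / sqrt (1 - s\<^sup>2)) (at s)"
  using sq_less_1[of s] by (auto intro!: derivative_eq_intros simp: divide_simps)

lemma DERIV_slope_circle:
  assumes "\<bar>s\<bar> < 1"
  shows "((\<lambda>s. s / sqrt (1 - s\<^sup>2)) has_real_derivative 1 / ((1 - s\<^sup>2) * sqrt (1 - s\<^sup>2))) (at s)"
proof -
  define c where "c = sqrt (1 - s\<^sup>2)"
  have c: "c > 0" "c\<^sup>2 = 1 - s\<^sup>2"
    using sq_less_1[OF assms] by (auto simp: c_def)
  have "((\<lambda>s. s / sqrt (1 - s\<^sup>2)) has_real_derivative (1 * c - s * (- s / c)) / (c * c)) (at s)"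
    unfolding c_def using c by (intro DERIV_divide DERIV_ident DERIV_sqrt_circle assms) (simp add: c_def)
  also have "(1 * c - s * (- s / c)) / (c * c) = (c\<^sup>2 + s\<^sup>2) / (c\<^sup>2 * c)"
    using c by (simp add: field_simps power2_eq_square)
  also have "\<dots> = 1 / ((1 - s\<^sup>2) * c)"
    unfolding c(2) by simp
  finally show ?thesis
    by (simp add: c_def)
qed

section \<open>The equation in polar variables\<close>

locale half_plane_solution =
  fixes f :: "real \<times> real \<Rightarrow> real"
  assumes cont: "continuous_on closed_half_plane f"
    and smooth: "smooth_on open_half_plane f"
    and nonneg: "\<And>p. p \<in> closed_half_plane \<Longrightarrow> f p \<ge> 0"
    and equation: "\<And>p. p \<in> open_half_plane \<Longrightarrow>
      partial_x (partial_x f) p + partial_y (partial_y f) p + 3 / fst p * partial_x f p = 0"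
begin

lemma dpart_differentiable: "p \<in> open_half_plane \<Longrightarrow> dpart bs f differentiable (at p)"
proof -
  assume p: "p \<in> open_half_plane"
  have "open open_half_plane"
    unfolding open_half_plane_def by (intro open_Collect_less continuous_intros)
  with p smooth show ?thesis
    unfolding smooth_on_def differentiable_on_def by (metis at_within_open)
qed

lemma dpart_continuous: "continuous_on open_half_plane (dpart bs f)"
  using smooth by (simp add: smooth_on_def differentiable_imp_continuous_on)

text \<open>Stated for every iterated partial, so that it gives the first derivatives from
  \<open>f\<close> and then the second ones from the partials of \<open>f\<close>.\<close>

lemma DERIV_dpart_pt_t:
  assumes "\<bar>s\<bar> < 1"
  shows "((\<lambda>t. dpart bs f (pt t s)) has_real_derivative
    exp t * (sqrt (1 - s\<^sup>2) * dpart (True # bs) f (pt t s) + s * dpart (False # bs) f (pt t s))) (at t)"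
proof -
  have "dpart bs f differentiable (at (exp t * sqrt (1 - s\<^sup>2), exp t * s))"
    using dpart_differentiable[OF pt_open[OF assms]] by (simp add: pt_def)
  from partials_chain_rule[of _ "\<lambda>t. exp t * sqrt (1 - s\<^sup>2)" t "\<lambda>t. exp t * s",
      OF this DERIV_cmult_right[OF DERIV_exp] DERIV_cmult_right[OF DERIV_exp]]
  show ?thesis
    by (simp add: pt_def algebra_simps)
qed

lemma DERIV_dpart_pt_s:
  assumes "\<bar>s\<bar> < 1"
  shows "((\<lambda>s. dpart bs f (pt t s)) has_real_derivative
    exp t * (dpart (False # bs) f (pt t s) - s / sqrt (1 - s\<^sup>2) * dpart (True # bs) f (pt t s))) (at s)"
proof -
  have "dpart bs f differentiable (at (exp t * sqrt (1 - s\<^sup>2), exp t * s))"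
    using dpart_differentiable[OF pt_open[OF assms]] by (simp add: pt_def)
  from partials_chain_rule[of _ "\<lambda>s. exp t * sqrt (1 - s\<^sup>2)" s "\<lambda>s. exp t * s",
      OF this DERIV_cmult[OF DERIV_sqrt_circle[OF assms]] DERIV_cmult[OF DERIV_ident]]
  show ?thesis
    by (simp add: pt_def algebra_simps)
qed

text \<open>Together with \<open>u_tt\<close>, \<open>u_s\<close> and \<open>u_ss\<close>, this is a
  chain-rule value of a derivative of \<open>polar f\<close>. The closed forms make joint continuity
  in \<open>t\<close> and \<open>s\<close> visible, and the two mixed partials stay separate
  terms.\<close>

definition "u_t t s = exp t * (sqrt (1 - s\<^sup>2) * dpart [True] f (pt t s) + s * dpart [False] f (pt t s))"

definition "u_tt t s = u_t t s + (exp t)\<^sup>2 *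
  ((1 - s\<^sup>2) * dpart [True, True] f (pt t s) + s * sqrt (1 - s\<^sup>2) * dpart [True, False] f (pt t s)
   + s * sqrt (1 - s\<^sup>2) * dpart [False, True] f (pt t s) + s\<^sup>2 * dpart [False, False] f (pt t s))"

definition "u_s t s = exp t * (dpart [False] f (pt t s) - s / sqrt (1 - s\<^sup>2) * dpart [True] f (pt t s))"

definition "u_ss t s = (exp t)\<^sup>2 * (dpart [False, False] f (pt t s)
  - s / sqrt (1 - s\<^sup>2) * dpart [True, False] f (pt t s)
  - s / sqrt (1 - s\<^sup>2) * dpart [False, True] f (pt t s)
  + s\<^sup>2 / (1 - s\<^sup>2) * dpart [True, True] f (pt t s))
  - exp t / ((1 - s\<^sup>2) * sqrt (1 - s\<^sup>2)) * dpart [True] f (pt t s)"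

lemma DERIV_polar_t: "\<bar>s\<bar> < 1 \<Longrightarrow> ((\<lambda>t. polar f t s) has_real_derivative u_t t s) (at t)"
  using DERIV_dpart_pt_t[of s "[]"] by (simp add: polar_def u_t_def)

lemma DERIV_u_t:
  assumes "\<bar>s\<bar> < 1" shows "((\<lambda>t. u_t t s) has_real_derivative u_tt t s) (at t)"
proof -
  define c where "c = sqrt (1 - s\<^sup>2)"
  have cc: "1 - s\<^sup>2 = c\<^sup>2"
    using sq_less_1[OF assms] by (simp add: c_def)
  note D = DERIV_cmult[OF DERIV_dpart_pt_t[OF assms]]
  show ?thesis
    unfolding u_t_def
    by (rule DERIV_cong[OF DERIV_mult[OF DERIV_exp DERIV_add[OF D D]]], unfold u_tt_def u_t_def,
        fold c_def, unfold cc) algebra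
qed

lemma DERIV_polar_s: "\<bar>s\<bar> < 1 \<Longrightarrow> ((\<lambda>s. polar f t s) has_real_derivative u_s t s) (at s)"
  using DERIV_dpart_pt_s[of s "[]"] by (simp add: polar_def u_s_def)

lemma DERIV_u_s:
  assumes "\<bar>s\<bar> < 1" shows "((\<lambda>s. u_s t s) has_real_derivative u_ss t s) (at s)"
proof -
  note D = DERIV_dpart_pt_s[OF assms] DERIV_slope_circle[OF assms]
  have "(sqrt (1 - s\<^sup>2))\<^sup>2 = 1 - s\<^sup>2"
    using sq_less_1[OF assms] by simp
  then have "s\<^sup>2 / (1 - s\<^sup>2) = (s / sqrt (1 - s\<^sup>2))\<^sup>2"
    by (simp add: power_divide)
  then have u_ss: "u_ss t s = (exp t)\<^sup>2 * (dpart [False, False] f (pt t s)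
      - s / sqrt (1 - s\<^sup>2) * dpart [True, False] f (pt t s)
      - s / sqrt (1 - s\<^sup>2) * dpart [False, True] f (pt t s)
      + (s / sqrt (1 - s\<^sup>2))\<^sup>2 * dpart [True, True] f (pt t s))
      - exp t * (1 / ((1 - s\<^sup>2) * sqrt (1 - s\<^sup>2))) * dpart [True] f (pt t s)"
    unfolding u_ss_def by simp
  show ?thesis
    unfolding u_s_def
    by (rule DERIV_cong[OF DERIV_cmult[OF DERIV_diff[OF D(1) DERIV_mult[OF D(2) D(1)]]]], unfold u_ss) algebra
qed

text \<open>This is the given equation multiplied by the squared radius \<open>E\<^sup>2\<close>,
  with \<open>x = E * c\<close>. Each mixed partial cancels against itself, and
  \<open>c\<^sup>2 + s\<^sup>2 = 1\<close> restores the Laplacian.\<close>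

lemma polar_equation:
  assumes "\<bar>s\<bar> < 1"
  shows "u_tt t s + 3 * u_t t s + (1 - s\<^sup>2) * u_ss t s - 4 * s * u_s t s = 0"
proof -
  define c where "c = sqrt (1 - s\<^sup>2)"
  have c: "c > 0" and cc: "1 - s\<^sup>2 = c\<^sup>2"
    using sq_less_1[OF assms] by (auto simp: c_def)
  have ss: "s\<^sup>2 = 1 - c\<^sup>2" using cc by simp
  define F where "F bs = dpart bs f (pt t s)" for bs
  define E where "E = exp t"
  have E: "E > 0" by (simp add: E_def)
  have "E\<^sup>2 * (F [True, True] + F [False, False] + 3 / (E * c) * F [True]) = 0"
    using equation[OF pt_open[OF assms, of t]] by (simp add: F_def pt_def E_def c_def)
  then have eq: "E\<^sup>2 * F [True, True] + E\<^sup>2 * F [False, False] + 3 * E / c * F [True] = 0"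
    using E by (simp add: distrib_left power2_eq_square mult.assoc mult.left_commute)
  have 1: "u_tt t s + 3 * u_t t s = E\<^sup>2 * (c\<^sup>2 * F [True, True] + s * c * F [True, False]
      + s * c * F [False, True] + s\<^sup>2 * F [False, False]) + 4 * E * (c * F [True] + s * F [False])"
    unfolding u_tt_def u_t_def F_def[symmetric] E_def[symmetric] c_def[symmetric] unfolding cc by algebra
  have 2: "(1 - s\<^sup>2) * u_ss t s - 4 * s * u_s t s = E\<^sup>2 * (c\<^sup>2 * F [False, False] - s * c * F [True, False]
      - s * c * F [False, True] + s\<^sup>2 * F [True, True]) - E / c * F [True]
      + 4 * E * s\<^sup>2 / c * F [True] - 4 * E * s * F [False]"
    unfolding u_ss_def u_s_def F_def[symmetric] E_def[symmetric] c_def[symmetric] unfolding cc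
    using c by (simp add: field_simps power2_eq_square)
  \<comment> \<open>The remaining first-order terms combine to exactly the singular drift
    \<open>3 / x\<close> of the equation, scaled by \<open>E\<^sup>2\<close>.\<close>
  have 3: "4 * E * c * F [True] - E / c * F [True] + 4 * E * s\<^sup>2 / c * F [True] = 3 * E / c * F [True]"
    using c unfolding ss by (simp add: field_simps power2_eq_square)
  have "u_tt t s + 3 * u_t t s + ((1 - s\<^sup>2) * u_ss t s - 4 * s * u_s t s)
    = E\<^sup>2 * (c\<^sup>2 + s\<^sup>2) * (F [True, True] + F [False, False])
      + (4 * E * c * F [True] - E / c * F [True] + 4 * E * s\<^sup>2 / c * F [True])"
    unfolding 1 2 by (simp add: algebra_simps)
  also have "\<dots> = E\<^sup>2 * F [True, True] + E\<^sup>2 * F [False, False] + 3 * E / c * F [True]"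
    unfolding 3 unfolding ss by (simp add: distrib_left)
  finally show ?thesis
    using eq by simp
qed

section \<open>Continuity and bounds in polar variables\<close>

lemma continuous_on_polar: "continuous_on {-1..1} (polar f t)"
proof -
  have "continuous_on {-1..1} (\<lambda>s. f (pt t s))"
    by (rule continuous_on_compose2[OF cont])
       (auto simp: pt_def intro!: continuous_intros pt_closed[unfolded pt_def])
  then show ?thesis
    by (simp add: polar_def[abs_def])
qed

lemma continuous_on_polar_subset: "A \<subseteq> {-1..1} \<Longrightarrow> continuous_on A (polar f t)"
  by (rule continuous_on_subset[OF continuous_on_polar])

lemma polar_nonneg: "\<bar>s\<bar> \<le> 1 \<Longrightarrow> polar f t s \<ge> 0"
  unfolding polar_def by (intro nonneg pt_closed)

text \<open>The points with \<open>t \<le> b\<close> lie in a closed half-disc, which is compact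
  because it contains the origin and the axis. Hence the bound stays uniform as \<open>t\<close>
  tends to minus infinity.\<close>

lemma polar_bounded:
  obtains B where "B > 0" "\<And>t s. t \<le> b \<Longrightarrow> \<bar>s\<bar> \<le> 1 \<Longrightarrow> \<bar>polar f t s\<bar> \<le> B"
proof -
  define D where "D = cball 0 (exp b) \<inter> closed_half_plane"
  have "closed closed_half_plane"
    unfolding closed_half_plane_def by (intro closed_Collect_le continuous_intros)
  then have "compact D"
    unfolding D_def by (intro compact_Int_closed compact_cball)
  moreover have "continuous_on D f"
    by (rule continuous_on_subset[OF cont]) (simp add: D_def)
  ultimately have "bounded (f ` D)"
    by (intro compact_imp_bounded compact_continuous_image)
  then obtain B where B: "B > 0" "\<And>p. p \<in> D \<Longrightarrow> \<bar>f p\<bar> \<le> B"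
    by (auto simp: bounded_pos)
  have "pt t s \<in> D" if "t \<le> b" "\<bar>s\<bar> \<le> 1" for t s
  proof -
    have "1 - s\<^sup>2 \<ge> 0"
      using that by (simp add: abs_square_le_1)
    then have "norm (pt t s) = exp t"
      by (simp add: pt_def norm_Pair power_mult_distrib flip: distrib_left)
    then show ?thesis
      using that by (simp add: D_def pt_closed)
  qed
  with B that show ?thesis
    by (metis polar_def)
qed

lemma continuous_on_dpart_pt:
  "A \<subseteq> UNIV \<times> {-1<..<1} \<Longrightarrow> continuous_on A (\<lambda>p. dpart bs f (pt (fst p) (snd p)))"
  by (rule continuous_on_compose2[OF dpart_continuous continuous_on_pt])
     (use pt_open in \<open>fastforce simp: abs_less_iff\<close>)

lemma continuous_on_u_t:
  "A \<subseteq> UNIV \<times> {-1<..<1} \<Longrightarrow> continuous_on A (\<lambda>p. u_t (fst p) (snd p))"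
  unfolding u_t_def by (intro continuous_intros continuous_on_dpart_pt)

lemma continuous_on_u_tt:
  "A \<subseteq> UNIV \<times> {-1<..<1} \<Longrightarrow> continuous_on A (\<lambda>p. u_tt (fst p) (snd p))"
  unfolding u_tt_def by (intro continuous_intros continuous_on_dpart_pt continuous_on_u_t)

text \<open>Differentiate twice under the integral, replace the \<open>t\<close>-derivatives by the
  equation, and integrate by parts twice in \<open>s\<close>. The bound \<open>a < 1\<close> keeps
  the integrals where derivatives exist, and \<open>G\<close> vanishing at both ends removes
  \<open>u_s\<close> from the boundary term.\<close>

lemma weighted_integral_ode:
  assumes a: "0 \<le> a" "a < 1"
    and G: "\<And>s. (G has_real_derivative G' s) (at s)"
    and G': "\<And>s. (G' has_real_derivative G'' s) (at s)"
    and G'': "continuous_on UNIV G''" and zero: "G a = 0" "G (- a) = 0"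
  defines "J \<equiv> \<lambda>u. integral {-a..a} (\<lambda>s. u s * G s)"
  shows "((\<lambda>t. J (polar f t)) has_real_derivative J (u_t t)) (at t)"
    and "((\<lambda>t. J (u_t t)) has_real_derivative J (u_tt t)) (at t)"
    and "J (u_tt t) + 3 * J (u_t t) =
      - integral {-a..a} (\<lambda>s. polar f t s * ((1 - s\<^sup>2) * G'' s + 2 * G s))
      + (1 - a\<^sup>2) * (polar f t a * G' a - polar f t (- a) * G' (- a))"
proof -
  have s: "\<bar>s\<bar> < 1" if "s \<in> {-a..a}" for s
    using that a by auto
  have contG: "continuous_on A G" "continuous_on A G'" "continuous_on A G''" for A
    using G G' G'' by (auto intro: DERIV_continuous_on DERIV_subset continuous_on_subset)
  have sub: "UNIV \<times> {-a..a} \<subseteq> UNIV \<times> {-1<..<1}" "{x} \<times> {-a..a} \<subseteq> UNIV \<times> {-1<..<1}" "{-a..a} \<subseteq> {-1..1}" for x :: real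
    using a by auto
  have cu: "continuous_on {-a..a} (u_t t)" "continuous_on {-a..a} (u_tt t)" for t
    using continuous_on_compose2[OF continuous_on_u_t[OF sub(2)[of t]], of "{-a..a}" "\<lambda>s. (t, s)"]
      continuous_on_compose2[OF continuous_on_u_tt[OF sub(2)[of t]], of "{-a..a}" "\<lambda>s. (t, s)"]
    by (auto simp: continuous_on_Pair[OF continuous_on_const continuous_on_id, unfolded id_def])
  have int: "(\<lambda>s. polar f t s * G s) integrable_on {-a..a}" "(\<lambda>s. u_t t s * G s) integrable_on {-a..a}"
    "(\<lambda>s. u_tt t s * G s) integrable_on {-a..a}" for t
    by (intro integrable_continuous_real continuous_intros contG cu continuous_on_polar_subset sub)+
  have contG2: "continuous_on (UNIV \<times> {-a..a}) (\<lambda>p::real \<times> real. G (snd p))"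
    by (rule continuous_on_compose2[OF contG(1)[of UNIV]]) (auto intro: continuous_intros)
  have "((\<lambda>t. integral (cbox (-a) a) (\<lambda>s. polar f t s * G s)) has_real_derivative
      integral (cbox (-a) a) (\<lambda>s. u_t t s * G s)) (at t)"
  proof (rule leibniz_rule_field_derivative[where U = UNIV])
    show "continuous_on (UNIV \<times> cbox (-a) a) (\<lambda>(t, s). u_t t s * G s)"
      unfolding split_beta cbox_interval by (intro continuous_intros continuous_on_u_t contG2 sub)
  qed (use int s in \<open>auto intro!: DERIV_cmult_right DERIV_polar_t\<close>)
  then show "((\<lambda>t. J (polar f t)) has_real_derivative J (u_t t)) (at t)"
    by (simp add: J_def)
  have "((\<lambda>t. integral (cbox (-a) a) (\<lambda>s. u_t t s * G s)) has_real_derivative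
      integral (cbox (-a) a) (\<lambda>s. u_tt t s * G s)) (at t)"
  proof (rule leibniz_rule_field_derivative[where U = UNIV])
    show "continuous_on (UNIV \<times> cbox (-a) a) (\<lambda>(t, s). u_tt t s * G s)"
      unfolding split_beta cbox_interval by (intro continuous_intros continuous_on_u_tt contG2 sub)
  qed (use int s in \<open>auto intro!: DERIV_cmult_right DERIV_u_t\<close>)
  then show "((\<lambda>t. J (u_t t)) has_real_derivative J (u_tt t)) (at t)"
    by (simp add: J_def)
  \<comment> \<open>\<open>P\<close> is the bilinear concomitant: with
    \<open>L u = (1 - s\<^sup>2) * u_ss - 4 * s * u_s\<close>, its derivative is
    \<open>G * L u\<close> minus \<open>u\<close> times the formal adjoint of \<open>L\<close>
    applied to \<open>G\<close>. That adjoint is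
    \<open>(1 - s\<^sup>2) * G'' + 2 * G\<close>.\<close>
  define P where "P = (\<lambda>s. (1 - s\<^sup>2) * u_s t s * G s - polar f t s * (1 - s\<^sup>2) * G' s - 2 * s * polar f t s * G s)"
  define Q where "Q = (\<lambda>s. polar f t s * ((1 - s\<^sup>2) * G'' s + 2 * G s))"
  have "(P has_real_derivative - u_tt t s * G s - 3 * (u_t t s * G s) - Q s) (at s)"
    if "s \<in> {-a..a}" for s
  proof -
    note D = DERIV_polar_s[OF s[OF that], of t] DERIV_u_s[OF s[OF that], of t]
    have "(P has_real_derivative ((1 - s\<^sup>2) * u_ss t s - 4 * s * u_s t s) * G s - Q s) (at s)"
      unfolding P_def Q_def
      by (rule derivative_eq_intros D G G' refl)+ (simp add: algebra_simps power2_eq_square)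
    also have "(1 - s\<^sup>2) * u_ss t s - 4 * s * u_s t s = - u_tt t s - 3 * u_t t s"
      using polar_equation[OF s[OF that], of t] by linarith
    finally show ?thesis
      by (simp add: algebra_simps)
  qed
  then have "((\<lambda>s. - u_tt t s * G s - 3 * (u_t t s * G s) - Q s) has_integral P a - P (- a)) {-a..a}"
    using a by (intro fundamental_theorem_of_calculus)
      (auto simp flip: has_real_derivative_iff_has_vector_derivative intro: DERIV_subset)
  moreover have "((\<lambda>s. - (u_tt t s * G s) - 3 * (u_t t s * G s) - Q s) has_integral
      - J (u_tt t) - 3 * J (u_t t) - integral {-a..a} Q) {-a..a}"
    unfolding J_def
  proof (intro has_integral_diff has_integral_neg has_integral_mult_right integrable_integral int)
    show "Q integrable_on {-a..a}"
      unfolding Q_def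
      by (intro integrable_continuous_real continuous_intros contG continuous_on_polar_subset sub)
  qed
  ultimately have "P a - P (- a) = - J (u_tt t) - 3 * J (u_t t) - integral {-a..a} Q"
    by (simp add: has_integral_unique)
  then show "J (u_tt t) + 3 * J (u_t t) =
      - integral {-a..a} (\<lambda>s. polar f t s * ((1 - s\<^sup>2) * G'' s + 2 * G s))
      + (1 - a\<^sup>2) * (polar f t a * G' a - polar f t (- a) * G' (- a))"
    unfolding P_def Q_def zero by (simp add: algebra_simps)
qed

section \<open>Moments\<close>

definition moment :: "real \<Rightarrow> nat \<Rightarrow> real \<Rightarrow> real" where
  "moment a n t = integral {-a..a} (\<lambda>s. polar f t s * (s ^ n * (a\<^sup>2 - s\<^sup>2)))"

lemma moment_integrable:
  assumes "a \<le> 1"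
  shows "(\<lambda>s. polar f t s * (s ^ n * (a\<^sup>2 - s\<^sup>2))) integrable_on {-a..a}"
  using assms
  by (intro integrable_continuous_real continuous_intros continuous_on_polar_subset) auto

text \<open>For \<open>n < 2\<close> the truncated index \<open>n - 2\<close> is harmless: its coefficient vanishes.\<close>

lemma moment_ode:
  fixes n :: nat
  assumes a: "0 \<le> a" "a < 1"
  obtains M' M'' where
    "\<And>t. (moment a n has_real_derivative M' t) (at t)"
    "\<And>t. (M' has_real_derivative M'' t) (at t)"
    "\<And>t B. (\<And>s. \<bar>s\<bar> \<le> 1 \<Longrightarrow> \<bar>polar f t s\<bar> \<le> B) \<Longrightarrow>
      \<bar>M'' t + 3 * M' t - real n * (real n + 3) * moment a n t + real n * (real n - 1) * moment a (n - 2) t\<bar>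
        \<le> (8 * real n + 8) * B * (1 - a\<^sup>2)"
proof -
  define G where "G = (\<lambda>s. s ^ n * (a\<^sup>2 - s\<^sup>2))"
  define G' where "G' = (\<lambda>s::real. a\<^sup>2 * (real n * s ^ (n - 1)) - (real n + 2) * s ^ (n + 1))"
  define G'' where "G'' = (\<lambda>s::real. a\<^sup>2 * (real n * (real n - 1) * s ^ (n - 2)) - (real n + 2) * (real n + 1) * s ^ n)"
  have G: "(G has_real_derivative G' s) (at s)" for s
  proof -
    have G_eq: "G = (\<lambda>s. a\<^sup>2 * s ^ n - s ^ (n + 2))"
      by (simp add: G_def fun_eq_iff algebra_simps power2_eq_square)
    show ?thesis
      unfolding G_eq G'_def by (rule derivative_eq_intros refl)+ simp
  qed
  have G': "(G' has_real_derivative G'' s) (at s)" for s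
    unfolding G'_def G''_def
    by (rule derivative_eq_intros refl)+ (cases n; simp add: algebra_simps)
  have G'': "continuous_on UNIV G''"
    unfolding G''_def by (intro continuous_intros)
  have zero: "G a = 0" "G (- a) = 0"
    by (simp_all add: G_def)
  note ode = weighted_integral_ode[OF a G G' G'' zero]
  define J where "J = (\<lambda>u. integral {-a..a} (\<lambda>s. u s * G s))"
  have J: "moment a n = (\<lambda>t. J (polar f t))"
    by (simp add: J_def G_def moment_def fun_eq_iff)
  show thesis
  proof (rule that[of "\<lambda>t. J (u_t t)" "\<lambda>t. J (u_tt t)"])
    show "(moment a n has_real_derivative J (u_t t)) (at t)" for t
      using ode(1) by (simp add: J) (simp add: J_def)
    show "((\<lambda>t. J (u_t t)) has_real_derivative J (u_tt t)) (at t)" for t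
      using ode(2) by (simp add: J_def)
    fix t B assume B: "\<And>s. \<bar>s\<bar> \<le> 1 \<Longrightarrow> \<bar>polar f t s\<bar> \<le> B"
    have "B \<ge> 0"
      by (rule order_trans[OF abs_ge_zero B[of 0]]) simp
    have "a\<^sup>2 \<le> 1" "a \<le> 1"
      using a by (auto simp: power_le_one)
    define I where "I = integral {-a..a} (\<lambda>s. polar f t s * s ^ n)"
    define R where "R = polar f t a * G' a - polar f t (- a) * G' (- a)"
    \<comment> \<open>Expressing the adjoint through the weight \<open>a\<^sup>2 - s\<^sup>2\<close>
      leaves a remainder proportional to \<open>1 - a\<^sup>2\<close>, which disappears in the
      limit.\<close>
    have G''_eq: "(1 - s\<^sup>2) * G'' s + 2 * G s = real n * (real n - 1) * (s ^ (n - 2) * (a\<^sup>2 - s\<^sup>2))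
        - real n * (real n + 3) * (s ^ n * (a\<^sup>2 - s\<^sup>2)) - (4 * real n + 2) * (1 - a\<^sup>2) * s ^ n" for s
      unfolding G_def G''_def
      by (cases n rule: nat_cases_2) (simp_all add: algebra_simps power2_eq_square)
    have cont: "continuous_on {-a..a} (\<lambda>s. polar f t s * s ^ n)"
      by (intro continuous_intros continuous_on_polar_subset) (use a in auto)
    have "((\<lambda>s. real n * (real n - 1) * (polar f t s * (s ^ (n - 2) * (a\<^sup>2 - s\<^sup>2)))
        - real n * (real n + 3) * (polar f t s * (s ^ n * (a\<^sup>2 - s\<^sup>2))) - (4 * real n + 2) * (1 - a\<^sup>2) * (polar f t s * s ^ n))
      has_integral real n * (real n - 1) * moment a (n - 2) t - real n * (real n + 3) * moment a n t
        - (4 * real n + 2) * (1 - a\<^sup>2) * I) {-a..a}"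
      unfolding moment_def I_def using a cont
      by (intro has_integral_diff has_integral_mult_right integrable_integral moment_integrable
          integrable_continuous_real) auto
    then have int_eq: "integral {-a..a} (\<lambda>s. polar f t s * ((1 - s\<^sup>2) * G'' s + 2 * G s))
      = real n * (real n - 1) * moment a (n - 2) t - real n * (real n + 3) * moment a n t - (4 * real n + 2) * (1 - a\<^sup>2) * I"
      unfolding G''_eq by (intro integral_unique) (simp add: right_diff_distrib mult_ac)
    have "J (u_tt t) + 3 * J (u_t t) =
        - integral {-a..a} (\<lambda>s. polar f t s * ((1 - s\<^sup>2) * G'' s + 2 * G s)) + (1 - a\<^sup>2) * R"
      using ode(3)[of t] by (simp only: J_def R_def)
    then have "J (u_tt t) + 3 * J (u_t t) - real n * (real n + 3) * moment a n t + real n * (real n - 1) * moment a (n - 2) t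
      = ((4 * real n + 2) * I + R) * (1 - a\<^sup>2)"
      unfolding int_eq by (simp add: algebra_simps)
    \<comment> \<open>The integral \<open>I\<close> over an interval of length at most 2 is at most
      \<open>2 * B\<close>, contributing \<open>(8 * n + 4) * B\<close>; the two boundary values
      contribute \<open>2 * B\<close> each.\<close>
    moreover have "\<bar>(4 * real n + 2) * I + R\<bar> \<le> (8 * real n + 8) * B"
    proof -
      have "norm I \<le> B * (a - - a)"
        unfolding I_def
      proof (rule integral_bound[OF _ cont])
        fix s assume "s \<in> {-a..a}"
        then have "\<bar>s\<bar> \<le> 1"
          using a by auto
        then have "\<bar>polar f t s\<bar> * \<bar>s ^ n\<bar> \<le> B * 1"
          by (intro mult_mono B) (auto simp: power_abs power_le_one \<open>B \<ge> 0\<close>)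
        then show "norm (polar f t s * s ^ n) \<le> B"
          by (simp add: abs_mult)
      qed (use a in simp)
      also have "\<dots> \<le> B * 2"
        using a \<open>B \<ge> 0\<close> by (intro mult_left_mono) auto
      finally have "\<bar>(4 * real n + 2) * I\<bar> \<le> (4 * real n + 2) * (B * 2)"
        unfolding abs_mult by (intro mult_mono) auto
      \<comment> \<open>At the ends \<open>a\<^sup>2 = s\<^sup>2\<close>, so the terms with
        coefficient \<open>n\<close> in \<open>G'\<close> cancel and the bound is independent of
        \<open>n\<close>.\<close>
      moreover have "\<bar>polar f t s * G' s\<bar> \<le> B * 2" if "\<bar>s\<bar> = a" for s
      proof -
        have "a\<^sup>2 = s\<^sup>2"
          using that by auto
        then have "G' s = - 2 * s ^ (n + 1)"
          unfolding G'_def by (cases n) (simp_all add: algebra_simps power2_eq_square)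
        then have "\<bar>G' s\<bar> \<le> 2"
          using that a power_le_one[of a "n + 1"] by (simp add: abs_mult power_abs)
        then show ?thesis
          unfolding abs_mult using that \<open>a \<le> 1\<close> by (intro mult_mono B) (auto simp: \<open>B \<ge> 0\<close>)
      qed
      from this[of a] this[of "- a"] have "\<bar>R\<bar> \<le> 4 * B"
        unfolding R_def using a by linarith
      ultimately show ?thesis
        by (simp add: algebra_simps)
    qed
    ultimately show "\<bar>J (u_tt t) + 3 * J (u_t t) - real n * (real n + 3) * moment a n t
        + real n * (real n - 1) * moment a (n - 2) t\<bar> \<le> (8 * real n + 8) * B * (1 - a\<^sup>2)"
      using \<open>a\<^sup>2 \<le> 1\<close> by (simp add: abs_mult mult_right_mono)
  qed
qed

text \<open>Extended by zero, the truncated weight is \<open>max 0 (a\<^sup>2 - s\<^sup>2)\<close>,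
  which differs from \<open>1 - s\<^sup>2\<close> by at most \<open>1 - a\<^sup>2\<close> on an
  interval of length 2. The case \<open>a = 0\<close> bounds the full moment itself.\<close>

lemma moment_truncation_error:
  assumes a: "0 \<le> a" "a \<le> 1" and B: "\<And>s. \<bar>s\<bar> \<le> 1 \<Longrightarrow> \<bar>polar f t s\<bar> \<le> B"
  shows "\<bar>moment 1 n t - moment a n t\<bar> \<le> 2 * B * (1 - a\<^sup>2)"
proof -
  define w where "w = (\<lambda>s. 1 - s\<^sup>2 - max 0 (a\<^sup>2 - s\<^sup>2))"
  have "B \<ge> 0"
    by (rule order_trans[OF abs_ge_zero B[of 0]]) simp
  have "((\<lambda>s. polar f t s * (s ^ n * (a\<^sup>2 - s\<^sup>2))) has_integral moment a n t) {-a..a}"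
    unfolding moment_def using a by (intro integrable_integral moment_integrable)
  then have "((\<lambda>s. if s \<in> {-a..a} then polar f t s * (s ^ n * (a\<^sup>2 - s\<^sup>2)) else 0)
      has_integral moment a n t) {-1..1}"
    using a by (subst has_integral_restrict) auto
  moreover have "(if s \<in> {-a..a} then polar f t s * (s ^ n * (a\<^sup>2 - s\<^sup>2)) else 0)
      = polar f t s * (s ^ n * max 0 (a\<^sup>2 - s\<^sup>2))" for s
    using abs_le_square_iff[of s a] a by (auto simp: max_def abs_le_iff)
  moreover have "((\<lambda>s. polar f t s * (s ^ n * (1\<^sup>2 - s\<^sup>2))) has_integral moment 1 n t) {-1..1}"
    unfolding moment_def by (intro integrable_integral moment_integrable) simp
  ultimately have "((\<lambda>s. polar f t s * (s ^ n * (1\<^sup>2 - s\<^sup>2)) - polar f t s * (s ^ n * max 0 (a\<^sup>2 - s\<^sup>2)))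
      has_integral moment 1 n t - moment a n t) {-1..1}"
    by (intro has_integral_diff) simp_all
  then have "((\<lambda>s. polar f t s * s ^ n * w s) has_integral moment 1 n t - moment a n t) {-1..1}"
    by (simp add: w_def algebra_simps)
  moreover have "norm (integral {-1..1} (\<lambda>s. polar f t s * s ^ n * w s)) \<le> B * (1 - a\<^sup>2) * (1 - - 1)"
  proof (rule integral_bound)
    show "continuous_on {-1..1} (\<lambda>s. polar f t s * s ^ n * w s)"
      unfolding w_def by (intro continuous_intros continuous_on_polar)
    fix s :: real assume "s \<in> {-1..1}"
    then have s: "\<bar>s\<bar> \<le> 1" "s\<^sup>2 \<le> 1"
      by (auto simp: abs_square_le_1)
    have "a\<^sup>2 \<le> 1" using a by (simp add: power_le_one)
    with s have "\<bar>w s\<bar> \<le> 1 - a\<^sup>2"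
      by (auto simp: w_def)
    moreover have "\<bar>polar f t s\<bar> * \<bar>s ^ n\<bar> \<le> B * 1"
      by (intro mult_mono B) (use s in \<open>auto simp: power_abs power_le_one \<open>B \<ge> 0\<close>\<close>)
    ultimately have "\<bar>polar f t s\<bar> * \<bar>s ^ n\<bar> * \<bar>w s\<bar> \<le> (B * 1) * (1 - a\<^sup>2)"
      using \<open>B \<ge> 0\<close> mult_mono[of "\<bar>polar f t s\<bar> * \<bar>s ^ n\<bar>" "B * 1" "\<bar>w s\<bar>" "1 - a\<^sup>2"] by simp
    then show "norm (polar f t s * s ^ n * w s) \<le> B * (1 - a\<^sup>2)"
      by (simp add: abs_mult)
  qed simp
  ultimately show ?thesis
    by (simp add: integral_unique algebra_simps)
qed

section \<open>Moments do not depend on the radius\<close>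

text \<open>\<open>K\<close> is the equilibrium of the moment equation with constant source
  \<open>k\<close>; for \<open>n = 0\<close> every \<open>K\<close> is one. The truncated moments
  obey this equation up to a multiple of \<open>\<delta> = 1 - \<alpha>\<^sup>2\<close>, and letting
  \<open>\<delta>\<close> tend to 0 leaves only the two barriers.\<close>

lemma moment_comparison:
  fixes n :: nat
  assumes K: "real n * (real n + 3) * K = real n * (real n - 1) * k"
    and k: "n \<le> 1 \<or> (\<forall>t. moment 1 (n - 2) t = k)" and t: "t \<in> {a..b}"
  shows "\<bar>moment 1 n t - K\<bar> \<le> \<bar>moment 1 n a - K\<bar> * exp (- (real n + 3) * (t - a))
    + \<bar>moment 1 n b - K\<bar> * exp (real n * (t - b))"
proof -
  define p where "p = exp (- (real n + 3) * (t - a))"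
  define q where "q = exp (real n * (t - b))"
  have pq: "0 \<le> p" "p \<le> 1" "0 \<le> q" "q \<le> 1"
    using t by (auto simp: p_def q_def mult_nonneg_nonpos mult_nonpos_nonneg)
  obtain B where B: "B > 0" "\<And>t s. t \<le> b \<Longrightarrow> \<bar>s\<bar> \<le> 1 \<Longrightarrow> \<bar>polar f t s\<bar> \<le> B"
    using polar_bounded by metis
  \<comment> \<open>The first summand is the error in the truncated moment equation; the second
    comes from replacing the truncated moment of index \<open>n - 2\<close> by
    \<open>k\<close>.\<close>
  define C where "C = (8 * real n + 8) * B + real n * \<bar>real n - 1\<bar> * (2 * B)"
  have "C > 0"
    using \<open>B > 0\<close> unfolding C_def by (intro add_pos_nonneg) simp_all
  \<comment> \<open>The \<open>6 * B\<close> collects three truncation errors of size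
    \<open>2 * B * \<delta>\<close>, at \<open>t\<close>, \<open>a\<close> and
    \<open>b\<close>.\<close>
  have est: "\<bar>moment 1 n t - K\<bar> \<le> \<bar>moment 1 n a - K\<bar> * p + \<bar>moment 1 n b - K\<bar> * q
      + (6 * B + C * (b - t)) * \<delta>" if \<delta>: "0 < \<delta>" "\<delta> < 1" for \<delta>
  proof -
    define \<alpha> where "\<alpha> = sqrt (1 - \<delta>)"
    have \<alpha>: "0 \<le> \<alpha>" "\<alpha> < 1" and \<delta>_eq: "1 - \<alpha>\<^sup>2 = \<delta>"
      using \<delta> by (auto simp: \<alpha>_def)
    obtain M' M'' where M: "\<And>t. (moment \<alpha> n has_real_derivative M' t) (at t)"
        "\<And>t. (M' has_real_derivative M'' t) (at t)"
      and ode: "\<And>t B. (\<And>s. \<bar>s\<bar> \<le> 1 \<Longrightarrow> \<bar>polar f t s\<bar> \<le> B) \<Longrightarrow>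
        \<bar>M'' t + 3 * M' t - real n * (real n + 3) * moment \<alpha> n t + real n * (real n - 1) * moment \<alpha> (n - 2) t\<bar>
          \<le> (8 * real n + 8) * B * (1 - \<alpha>\<^sup>2)"
      using moment_ode[OF \<alpha>, of n] by metis
    have err: "\<bar>moment 1 m x - moment \<alpha> m x\<bar> \<le> 2 * B * \<delta>" if "x \<le> b" for m x
      using moment_truncation_error[of \<alpha> x B m] \<alpha> B(2)[OF that] by (simp add: \<delta>_eq)
    have "\<bar>moment \<alpha> n t - K\<bar> \<le> \<bar>moment \<alpha> n a - K\<bar> * exp (- (real n + 3) * (t - a))
        + \<bar>moment \<alpha> n b - K\<bar> * exp (real n * (t - b)) + (C * \<delta>) * (b - t)"
    proof (rule euler_ode_bound[where g = "\<lambda>t. moment \<alpha> n t - K" and g' = M' and g'' = M''])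
      fix x assume x: "a < x" "x < b"
      have "\<bar>real n * (real n - 1) * (k - moment \<alpha> (n - 2) x)\<bar> \<le> real n * \<bar>real n - 1\<bar> * (2 * B * \<delta>)"
      proof (cases "n \<le> 1")
        case True
        then have "n = 0 \<or> n = 1" by auto
        then show ?thesis by auto
      next
        case False
        then have "moment 1 (n - 2) x = k" using k by simp
        with err[of x "n - 2"] x have "\<bar>k - moment \<alpha> (n - 2) x\<bar> \<le> 2 * B * \<delta>" by simp
        then show ?thesis
          unfolding abs_mult by (simp add: mult_left_mono)
      qed
      moreover have "\<bar>M'' x + 3 * M' x - real n * (real n + 3) * moment \<alpha> n x + real n * (real n - 1) * moment \<alpha> (n - 2) x\<bar>
          \<le> (8 * real n + 8) * B * \<delta>"
        using ode[OF B(2)] x by (simp add: \<delta>_eq)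
      moreover have "M'' x + 3 * M' x - real n * (real n + 3) * (moment \<alpha> n x - K)
        = (M'' x + 3 * M' x - real n * (real n + 3) * moment \<alpha> n x + real n * (real n - 1) * moment \<alpha> (n - 2) x)
          + real n * (real n - 1) * (k - moment \<alpha> (n - 2) x)"
        using K by (simp add: algebra_simps)
      moreover have "C * \<delta> = (8 * real n + 8) * B * \<delta> + real n * \<bar>real n - 1\<bar> * (2 * B * \<delta>)"
        by (simp add: C_def algebra_simps)
      ultimately show "\<bar>M'' x + 3 * M' x - real n * (real n + 3) * (moment \<alpha> n x - K)\<bar> \<le> C * \<delta>"
        by linarith
    qed (use M t \<open>C > 0\<close> \<delta> in \<open>auto intro!: derivative_eq_intros\<close>)
    then have "\<bar>moment \<alpha> n t - K\<bar> \<le> \<bar>moment \<alpha> n a - K\<bar> * p + \<bar>moment \<alpha> n b - K\<bar> * q + C * (b - t) * \<delta>"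
      by (simp add: p_def q_def mult_ac add_ac)
    moreover have "\<bar>moment \<alpha> n x - K\<bar> * r \<le> \<bar>moment 1 n x - K\<bar> * r + 2 * B * \<delta>"
      if "x \<le> b" "0 \<le> r" "r \<le> 1" for x r
    proof -
      have "\<bar>moment \<alpha> n x - K\<bar> \<le> \<bar>moment 1 n x - K\<bar> + 2 * B * \<delta>"
        using err[OF that(1), of n] by linarith
      then have "\<bar>moment \<alpha> n x - K\<bar> * r \<le> (\<bar>moment 1 n x - K\<bar> + 2 * B * \<delta>) * r"
        using that by (intro mult_right_mono)
      also have "\<dots> \<le> \<bar>moment 1 n x - K\<bar> * r + 2 * B * \<delta>"
        using mult_left_le[of r "2 * B * \<delta>"] that \<delta> \<open>B > 0\<close> by (simp add: distrib_right)
      finally show ?thesis .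
    qed
    from this[of a p] this[of b q] have "\<bar>moment \<alpha> n a - K\<bar> * p \<le> \<bar>moment 1 n a - K\<bar> * p + 2 * B * \<delta>"
      "\<bar>moment \<alpha> n b - K\<bar> * q \<le> \<bar>moment 1 n b - K\<bar> * q + 2 * B * \<delta>"
      using pq t by auto
    moreover have "\<bar>moment 1 n t - K\<bar> \<le> \<bar>moment \<alpha> n t - K\<bar> + 2 * B * \<delta>"
      using err[of t n] t by auto
    ultimately show ?thesis
      by (simp add: distrib_right)
  qed
  have "((\<lambda>\<delta>. \<bar>moment 1 n a - K\<bar> * p + \<bar>moment 1 n b - K\<bar> * q + (6 * B + C * (b - t)) * \<delta>)
      \<longlongrightarrow> \<bar>moment 1 n a - K\<bar> * p + \<bar>moment 1 n b - K\<bar> * q + (6 * B + C * (b - t)) * 0) (at_right 0)"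
    by (intro tendsto_intros)
  moreover have "eventually (\<lambda>\<delta>. \<bar>moment 1 n t - K\<bar> \<le>
      \<bar>moment 1 n a - K\<bar> * p + \<bar>moment 1 n b - K\<bar> * q + (6 * B + C * (b - t)) * \<delta>) (at_right 0)"
    using est by (auto simp: eventually_at_right_field intro!: exI[of _ 1])
  ultimately have "\<bar>moment 1 n t - K\<bar> \<le> \<bar>moment 1 n a - K\<bar> * p + \<bar>moment 1 n b - K\<bar> * q
      + (6 * B + C * (b - t)) * 0"
    by (rule tendsto_lowerbound) simp
  then show ?thesis
    by (simp add: p_def q_def add_ac)
qed

text \<open>Nonnegativity of \<open>f\<close> enters here. Once the zeroth moment is constant, this
  bounds every moment also for large \<open>t\<close>, where no bound on \<open>f\<close> is at
  hand.\<close>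

lemma abs_moment_le_moment_0: "\<bar>moment 1 n t\<bar> \<le> moment 1 0 t"
proof -
  have "norm (moment 1 n t) \<le> moment 1 0 t"
    unfolding moment_def
  proof (rule integral_norm_bound_integral)
    fix s :: real assume "s \<in> {-1..1}"
    then have s: "\<bar>s\<bar> \<le> 1" "1 - s\<^sup>2 \<ge> 0"
      by (auto simp: abs_square_le_1)
    then have "\<bar>s ^ n\<bar> \<le> 1"
      by (simp add: power_abs power_le_one)
    then show "norm (polar f t s * (s ^ n * (1\<^sup>2 - s\<^sup>2))) \<le> polar f t s * (s ^ 0 * (1\<^sup>2 - s\<^sup>2))"
      using s polar_nonneg[OF s(1), of t] by (auto simp: abs_mult intro!: mult_left_mono mult_left_le_one_le)
  qed (simp_all only: moment_integrable order_refl)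
  then show ?thesis
    by simp
qed

text \<open>Taking \<open>K\<close> to be the value at the right end \<open>t'\<close> makes the
  right barrier vanish. The left end recedes to minus infinity, where the moment stays bounded while
  its barrier decays.\<close>

lemma moment_0_constant: "moment 1 0 t = moment 1 0 t'"
proof (induction t t' rule: linorder_wlog)
  case (le t t')
  obtain B where B: "B > 0" "\<And>t s. t \<le> t' \<Longrightarrow> \<bar>s\<bar> \<le> 1 \<Longrightarrow> \<bar>polar f t s\<bar> \<le> B"
    using polar_bounded by metis
  have bound: "\<bar>moment 1 0 x\<bar> \<le> 2 * B" if "x \<le> t'" for x
    using moment_truncation_error[of 0 x B 0] B(2)[OF that] by (simp add: moment_def)
  have "\<bar>moment 1 0 t - moment 1 0 t'\<bar> \<le> 4 * B * exp (- x)" if "x \<ge> 0" for x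
  proof -
    have "\<bar>moment 1 0 t - moment 1 0 t'\<bar> \<le> \<bar>moment 1 0 (t - x) - moment 1 0 t'\<bar> * exp (- (3 * x))"
      using moment_comparison[of 0 "moment 1 0 t'" 0 t "t - x" t'] that le by simp
    also have "\<dots> \<le> (4 * B) * exp (- x)"
    proof (rule mult_mono)
      show "\<bar>moment 1 0 (t - x) - moment 1 0 t'\<bar> \<le> 4 * B"
        using bound[of "t - x"] bound[of t'] le that by linarith
    qed (use that \<open>B > 0\<close> in auto)
    finally show ?thesis .
  qed
  then have "\<bar>moment 1 0 t - moment 1 0 t'\<bar> \<le> 0"
    by (rule nonpos_if_le_exp_decay)
  then show ?case
    by simp
qed simp

lemma moment_constant: "\<exists>K. \<forall>t. moment 1 n t = K"
proof (induction n rule: less_induct)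
  case (less n)
  show ?case
  proof (cases "n = 0")
    case True
    then show ?thesis
      using moment_0_constant by blast
  next
    case False
    then obtain k where k: "\<forall>t. moment 1 (n - 2) t = k"
      using less[of "n - 2"] by auto
    \<comment> \<open>The equilibrium of the moment equation with source \<open>k\<close>; it is 0
      for \<open>n = 1\<close>, where the truncated index \<open>n - 2\<close> is 0.\<close>
    define K where "K = (real n - 1) * k / (real n + 3)"
    have K: "real n * (real n + 3) * K = real n * (real n - 1) * k"
      by (simp add: K_def)
    define D where "D = moment 1 0 0 + \<bar>K\<bar>"
    have D: "\<bar>moment 1 n t - K\<bar> \<le> D" for t
      using abs_moment_le_moment_0[of n t] moment_0_constant[of t 0] by (simp add: D_def)
    have "\<bar>moment 1 n t - K\<bar> \<le> (2 * D) * exp (- x)" if "x \<ge> 0" for t x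
    proof -
      have "\<bar>moment 1 n t - K\<bar> \<le> \<bar>moment 1 n (t - x) - K\<bar> * exp (- ((real n + 3) * x))
          + \<bar>moment 1 n (t + x) - K\<bar> * exp (- (real n * x))"
        using moment_comparison[OF K, of t "t - x" "t + x"] k that by (simp add: algebra_simps)
      also have "\<dots> \<le> D * exp (- x) + D * exp (- x)"
      proof (intro add_mono mult_mono D)
        \<comment> \<open>Both rates \<open>n\<close> and \<open>n + 3\<close> are at least 1
          because \<open>n\<close> is positive. For \<open>n = 0\<close> the growing barrier is
          constant, hence the separate treatment.\<close>
        have "1 * x \<le> real n * x" "1 * x \<le> (real n + 3) * x"
          using that False by (intro mult_right_mono; simp)+
        then show "exp (- ((real n + 3) * x)) \<le> exp (- x)" "exp (- (real n * x)) \<le> exp (- x)"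
          by simp_all
      qed (use D[of 0] in auto)
      finally show ?thesis
        by simp
    qed
    then have "\<bar>moment 1 n t - K\<bar> \<le> 0" for t
      by (rule nonpos_if_le_exp_decay)
    then show ?thesis
      by auto
  qed
qed

text \<open>By Weierstrass, a continuous function on \<open>[-1, 1]\<close> is determined by its moments.\<close>

lemma polar_radially_constant:
  assumes "\<bar>s\<bar> < 1"
  shows "polar f t s = polar f t' s"
proof -
  define d where "d = (\<lambda>s. polar f t s - polar f t' s)"
  define w where "w = (\<lambda>s::real. 1 - s\<^sup>2)"
  have w: "0 \<le> w s" "w s \<le> 1" if "s \<in> {-1..1}" for s
    using that by (auto simp: w_def abs_square_le_1 abs_le_iff)
  have d: "continuous_on {-1..1} d"
    unfolding d_def by (intro continuous_intros continuous_on_polar)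
  have [continuous_intros]: "continuous_on {-1..1} w"
    unfolding w_def by (intro continuous_intros)
  have zero: "((\<lambda>s. d s * w s * s ^ n) has_integral 0) {-1..1}" for n
  proof -
    have m: "((\<lambda>s. polar f x s * (s ^ n * (1\<^sup>2 - s\<^sup>2))) has_integral moment 1 n x) {-1..1}" for x
      unfolding moment_def by (intro integrable_integral moment_integrable) simp
    have "moment 1 n t = moment 1 n t'"
      using moment_constant[of n] by auto
    with has_integral_diff[OF m[of t] m[of t']] show ?thesis
      by (simp add: d_def w_def algebra_simps)
  qed
  have "bounded (d ` {-1..1})"
    using d by (intro compact_imp_bounded compact_continuous_image) auto
  then obtain D where D: "D > 0" "\<And>s. s \<in> {-1..1} \<Longrightarrow> \<bar>d s\<bar> \<le> D"
    unfolding bounded_pos by auto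
  \<comment> \<open>One factor \<open>d\<close> is approximated by a polynomial \<open>p\<close>.
    Vanishing moments make the integral of \<open>d * w * p\<close> zero, so only the approximation
    error remains.\<close>
  have "\<bar>integral {-1..1} (\<lambda>s. (d s)\<^sup>2 * w s)\<bar> \<le> e" if "e > 0" for e
  proof -
    \<comment> \<open>With \<open>d\<close> bounded by \<open>D\<close>, \<open>w\<close> by 1 and
      interval length 2, this tolerance yields exactly \<open>e\<close>.\<close>
    have "e / (2 * D) > 0"
      using that D by simp
    then obtain p where p: "real_polynomial_function p" "\<And>s. s \<in> {-1..1} \<Longrightarrow> \<bar>d s - p s\<bar> < e / (2 * D)"
      using Stone_Weierstrass_real_polynomial_function[OF compact_Icc d] by metis
    then obtain c N where pc: "p = (\<lambda>x. \<Sum>i\<le>N. c i * x ^ i)"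
      by (auto simp: real_polynomial_function_iff_sum)
    have cp: "continuous_on {-1..1} p"
      unfolding pc by (intro continuous_intros)
    have "((\<lambda>s. \<Sum>i\<le>N. c i * (d s * w s * s ^ i)) has_integral (\<Sum>i\<le>N. c i * 0)) {-1..1}"
      by (intro has_integral_sum has_integral_mult_right zero) simp
    then have "((\<lambda>s. d s * w s * p s) has_integral 0) {-1..1}"
      by (simp add: pc sum_distrib_left mult_ac)
    moreover have "((\<lambda>s. (d s)\<^sup>2 * w s) has_integral integral {-1..1} (\<lambda>s. (d s)\<^sup>2 * w s)) {-1..1}"
      by (intro integrable_integral integrable_continuous_real continuous_intros d)
    ultimately have "((\<lambda>s. (d s)\<^sup>2 * w s - d s * w s * p s) has_integral
        integral {-1..1} (\<lambda>s. (d s)\<^sup>2 * w s) - 0) {-1..1}"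
      by (intro has_integral_diff)
    then have "integral {-1..1} (\<lambda>s. (d s)\<^sup>2 * w s) = integral {-1..1} (\<lambda>s. (d s)\<^sup>2 * w s - d s * w s * p s)"
      by (simp add: integral_unique)
    also have "norm \<dots> \<le> (D * (e / (2 * D))) * (1 - - 1)"
    proof (rule integral_bound)
      show "continuous_on {-1..1} (\<lambda>s. (d s)\<^sup>2 * w s - d s * w s * p s)"
        by (intro continuous_intros d cp)
      fix s :: real assume s: "s \<in> {-1..1}"
      have "\<bar>d s\<bar> * \<bar>d s - p s\<bar> * \<bar>w s\<bar> \<le> D * (e / (2 * D)) * 1"
        using D(2)[OF s] p(2)[OF s] w[OF s] \<open>D > 0\<close> \<open>e > 0\<close> by (intro mult_mono) auto
      also have "\<bar>d s\<bar> * \<bar>d s - p s\<bar> * \<bar>w s\<bar> = norm ((d s)\<^sup>2 * w s - d s * w s * p s)"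
        unfolding real_norm_def abs_mult[symmetric] by (simp add: algebra_simps power2_eq_square)
      finally show "norm ((d s)\<^sup>2 * w s - d s * w s * p s) \<le> D * (e / (2 * D))"
        by simp
    qed simp
    finally show ?thesis
      using \<open>D > 0\<close> by simp
  qed
  then have "integral {-1..1} (\<lambda>s. (d s)\<^sup>2 * w s) = 0"
    using field_le_epsilon[of "\<bar>integral {-1..1} (\<lambda>s. (d s)\<^sup>2 * w s)\<bar>" 0] by simp
  moreover have "continuous_on {-1..1} (\<lambda>s. (d s)\<^sup>2 * w s)"
    by (intro continuous_intros d)
  ultimately have "\<forall>s\<in>{-1..1}. (d s)\<^sup>2 * w s = 0"
    using w by (subst (asm) integral_eq_0_iff) auto
  then have "(d s)\<^sup>2 * w s = 0"
    using assms by (auto simp: abs_less_iff)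
  then show ?thesis
    using sq_less_1[OF assms] by (simp add: d_def w_def)
qed

section \<open>From rays to the closed half-plane\<close>

lemma constant_on_open_half_plane:
  assumes "0 < x"
  shows "f (x, y) = f (0, 0)"
proof -
  define R where "R = sqrt (x\<^sup>2 + y\<^sup>2)"
  define s where "s = y / R"
  have R: "R > 0" "R\<^sup>2 = x\<^sup>2 + y\<^sup>2"
    using assms by (auto simp: R_def intro: add_pos_nonneg)
  have "1 - s\<^sup>2 = (R\<^sup>2 - y\<^sup>2) / R\<^sup>2"
    using R(1) by (simp add: s_def power_divide diff_divide_distrib)
  also have "\<dots> = (x / R)\<^sup>2"
    by (simp add: R(2) power_divide)
  finally have eq: "1 - s\<^sup>2 = (x / R)\<^sup>2" .
  have "x / R > 0"
    using R assms by simp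
  then have sqrt: "sqrt (1 - s\<^sup>2) = x / R"
    unfolding eq real_sqrt_abs by (rule abs_of_pos)
  have "(x / R)\<^sup>2 > 0"
    using \<open>x / R > 0\<close> by (rule zero_less_power)
  with eq have "s\<^sup>2 < 1"
    by linarith
  then have s: "\<bar>s\<bar> < 1"
    by (simp add: abs_square_less_1)
  \<comment> \<open>The right-hand points run along the ray from the origin through
    \<open>(x, y)\<close>. Letting \<open>r\<close> tend to 0 gives the value at the origin, which
    is common to all rays.\<close>
  have "f (x, y) = f (r * (x / R), r * s)" if "r > 0" for r
  proof -
    have "f (x, y) = polar f (ln R) s"
      using R unfolding polar_def pt_def sqrt by (simp add: s_def)
    also have "\<dots> = polar f (ln r) s"
      by (rule polar_radially_constant[OF s])
    also have "\<dots> = f (r * (x / R), r * s)"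
      using that unfolding polar_def pt_def sqrt by simp
    finally show ?thesis .
  qed
  then have "eventually (\<lambda>r. f (r * (x / R), r * s) = f (x, y)) (at_right 0)"
    by (auto simp: eventually_at_right_field intro!: exI[of _ 1])
  then have "((\<lambda>r. f (r * (x / R), r * s)) \<longlongrightarrow> f (x, y)) (at_right 0)"
    by (rule tendsto_eventually)
  moreover have "continuous_on {0..} (\<lambda>r. f (r * (x / R), r * s))"
    by (rule continuous_on_compose2[OF cont])
       (use assms R in \<open>auto intro!: continuous_intros simp: closed_half_plane_def\<close>)
  then have "((\<lambda>r. f (r * (x / R), r * s)) \<longlongrightarrow> f (0 * (x / R), 0 * s)) (at 0 within {0..})"
    unfolding continuous_on_def by (rule bspec) simp
  then have "((\<lambda>r. f (r * (x / R), r * s)) \<longlongrightarrow> f (0, 0)) (at_right 0)"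
    by (auto intro: tendsto_within_subset)
  ultimately show ?thesis
    by (rule tendsto_unique[rotated]) simp
qed

text \<open>A boundary point is the limit of interior points on the same horizontal line, so
  continuity carries the constant over to the axis.\<close>

lemma constant_on_closed_half_plane:
  assumes "p \<in> closed_half_plane"
  shows "f p = f (0, 0)"
proof -
  obtain x y where p: "p = (x, y)" "x \<ge> 0"
    using assms by (cases p) (auto simp: closed_half_plane_def)
  have "continuous_on {0..} (\<lambda>x. f (x, y))"
    by (rule continuous_on_compose2[OF cont])
       (auto intro!: continuous_intros simp: closed_half_plane_def)
  then have "((\<lambda>x. f (x, y)) \<longlongrightarrow> f (0, y)) (at 0 within {0..})"
    unfolding continuous_on_def by (rule bspec) simp
  then have "((\<lambda>x. f (x, y)) \<longlongrightarrow> f (0, y)) (at_right 0)"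
    by (auto intro: tendsto_within_subset)
  moreover have "eventually (\<lambda>x. f (x, y) = f (0, 0)) (at_right 0)"
    using constant_on_open_half_plane by (auto simp: eventually_at_right_field intro!: exI[of _ 1])
  then have "((\<lambda>x. f (x, y)) \<longlongrightarrow> f (0, 0)) (at_right 0)"
    by (rule tendsto_eventually)
  ultimately have "f (0, y) = f (0, 0)"
    by (rule tendsto_unique[rotated]) simp
  then show ?thesis
    using p constant_on_open_half_plane[of x y] by (cases "x = 0") auto
qed

end

theorem theorem4p14:
  fixes f :: "real \<times> real \<Rightarrow> real"
  assumes "continuous_on closed_half_plane f"
    and "smooth_on open_half_plane f"
    and "\<forall>p\<in>closed_half_plane. f p \<ge> 0"
    and "\<forall>p\<in>open_half_plane.
           partial_x (partial_x f) p + partial_y (partial_y f) p + 3 / fst p * partial_x f p = 0"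
  shows "\<exists>c. \<forall>p\<in>closed_half_plane. f p = c"
proof -
  interpret half_plane_solution f
    using assms by unfold_locales auto
  show ?thesis
    using constant_on_closed_half_plane by blast
qed

end
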